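(* Let $A$ be a closed symmetric relation in a Hilbert space $\mathcal H$ and let $\{\mathcal G,\Gamma_0,\Gamma_1\}$ be a quasi boundary triple for $A^*$ with $A_0=\ker\Gamma_0$, $\gamma$-field $\gamma$ and Weyl function $M$. Further, let $\Theta$ be a linear relation in $\mathcal G$ and assume that $\lambda\in\rho(A_0)$ is not an eigenvalue of $A_\Theta$, or, equivalently, that $\ker(\Theta-M(\lambda))=\{0\}$. Then the following assertions are true: (i) $g\in\operatorname{ran}(A_\Theta-\lambda)$ if and only if $\gamma(\overline\lambda)^*g\in\operatorname{dom}\,(\Theta-M(\lambda))^{-1}$; (ii) for all $g\in\operatorname{ran}(A_\Theta-\lambda)$ we have $$(A_\Theta-\lambda)^{-1}g=(A_0-\lambda)^{-1}g+\gamma(\lambda)\bigl(\Theta-M(\lambda)\bigr)^{-1}\gamma(\overline\lambda)^*g .$$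
   Context: Linear relations. A (closed) linear relation in a Hilbert space $\mathcal H$ is a (closed) linear subspace of $\mathcal H\times\mathcal H$; elements are written $\hat f=\binom{f}{f'}$, and operators are identified with their graphs. $\operatorname{dom}S=\{f:\exists f',\binom f{f'}\in S\}$, $\operatorname{ran}S=\{f':\exists f,\binom f{f'}\in S\}$, $\ker S=\{f:\binom f0\in S\}$, $S^{-1}=\{\binom{f'}{f}:\binom f{f'}\in S\}$, $S-\lambda=\{\binom{f}{f'-\lambda f}:\binom f{f'}\in S\}$. For a relation $\Theta$ and an operator $M$ in $\mathcal G$, $\Theta-M=\{\binom{x}{y-Mx}:\binom xy\in\Theta,\ x\in\operatorname{dom}M\}$. For closed $S$, $\rho(S)$ is the set of $\lambda\in\mathbb C$ such that $(S-\lambda)^{-1}$ is a bounded everywhere defined operator; $\lambda$ is an eigenvalue of $S$ if $\ker(S-\lambda)\neq\{0\}$. The adjoint is $S^*=\{\binom g{g'}:(f',g)=(f,g')\text{ for all }\binom f{f'}\in S\}$; $S$ is symmetric if $S\subset S^*$ and self-adjoint if $S=S^*$. Quasi boundary triples. Let $A$ be a closed symmetric relation in $\mathcal H$. $\{\mathcal G,\Gamma_0,\Gamma_1\}$ is a quasi boundary triple for $A^*$ if $\mathcal G$ is a Hilbert space and $\Gamma_0,\Gamma_1:T\to\mathcal G$ are linear mappings defined on a dense subspace $T$ of $A^*$ (dense in $A^*$ with respect to the topology of $\mathcal H\times\mathcal H$) such that $\Gamma=\binom{\Gamma_0}{\Gamma_1}:T\to\mathcal G\times\mathcal G$ has dense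 range, $\ker\Gamma_0$ is a self-adjoint relation in $\mathcal H$, and $(f',g)-(f,g')=(\Gamma_1\hat f,\Gamma_0\hat g)-(\Gamma_0\hat f,\Gamma_1\hat g)$ for all $\hat f=\binom f{f'},\hat g=\binom g{g'}\in T$. For a linear relation $\Theta$ in $\mathcal G$ put $A_\Theta=\{\hat f\in T:\Gamma\hat f\in\Theta\}$. $\gamma$-field and Weyl function. Let $A_0=\ker\Gamma_0$ and $\mathcal G_0=\operatorname{ran}\Gamma_0$. For $\lambda\in\rho(A_0)$ let $\hat{\mathcal N}_{\lambda,T}=\{\binom{f}{\lambda f}: f\in\ker(T-\lambda)\}$; then $\Gamma_0$ restricted to $\hat{\mathcal N}_{\lambda,T}$ is a bijection onto $\mathcal G_0$. With $\pi_1$ the projection of $\mathcal H\times\mathcal H$ onto the first component, define $\gamma(\lambda)=\pi_1(\Gamma_0\upharpoonright\hat{\mathcal N}_{\lambda,T})^{-1}:\mathcal G_0\to\mathcal H$ and $M(\lambda)=\Gamma_1(\Gamma_0\upharpoonright\hat{\mathcal N}_{\lambda,T})^{-1}:\mathcal G_0\to\mathcal G$, regarded as densely defined operators in $\mathcal G$ with domain $\mathcal G_0$; $\gamma(\lambda)$ is bounded, so $\gamma(\lambda)^*$ is a bounded everywhere defined operator from $\mathcal H$ to $\mathcal G$. *)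

theory Defs
  imports "HOL-Analysis.Analysis"
begin

section \<open>Complex Hilbert spaces\<close>

class scaleC =
  fixes scaleC :: "complex \<Rightarrow> 'a \<Rightarrow> 'a"  (infixr "*\<^sub>C" 75)

class complex_vector = real_vector + scaleC +
  assumes scaleC_add_right: "c *\<^sub>C (x + y) = c *\<^sub>C x + c *\<^sub>C y"
    and scaleC_add_left: "(c + d) *\<^sub>C x = c *\<^sub>C x + d *\<^sub>C x"
    and scaleC_scaleC: "c *\<^sub>C d *\<^sub>C x = (c * d) *\<^sub>C x"
    and scaleC_one: "1 *\<^sub>C x = x"
    and scaleC_of_real: "complex_of_real r *\<^sub>C x = r *\<^sub>R x"

interpretation cvec: vector_space "scaleC :: complex \<Rightarrow> 'a \<Rightarrow> 'a :: complex_vector"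
  by unfold_locales
    (simp_all add: scaleC_add_right scaleC_add_left scaleC_scaleC scaleC_one)

text \<open>The inner product is linear in its first argument.\<close>

class complex_inner = complex_vector + real_normed_vector +
  fixes cinner :: "'a \<Rightarrow> 'a \<Rightarrow> complex"
  assumes cinner_commute: "cinner x y = cnj (cinner y x)"
    and cinner_add_left: "cinner (x + y) z = cinner x z + cinner y z"
    and cinner_scaleC_left: "cinner (c *\<^sub>C x) y = c * cinner x y"
    and norm_eq_sqrt_cinner: "norm x = sqrt (Re (cinner x x))"
    and Re_cinner_ge_zero: "0 \<le> Re (cinner x x)"

class chilbert_space = complex_inner + complete_space

text \<open>The complex numbers are a Hilbert space, so the class is inhabited.\<close>

instantiation complex :: chilbert_space
begin

definition scaleC_complex :: "complex \<Rightarrow> complex \<Rightarrow> complex"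
  where "scaleC_complex c x = c * x"

definition cinner_complex :: "complex \<Rightarrow> complex \<Rightarrow> complex"
  where "cinner_complex x y = x * cnj y"

instance
  by standard
    (simp_all add: scaleC_complex_def cinner_complex_def algebra_simps scaleR_conv_of_real
      complex_norm_square[symmetric] cmod_def power2_eq_square)

end

instantiation prod :: (complex_vector, complex_vector) complex_vector
begin

definition scaleC_prod :: "complex \<Rightarrow> 'a \<times> 'b \<Rightarrow> 'a \<times> 'b"
  where "scaleC_prod c p = (c *\<^sub>C fst p, c *\<^sub>C snd p)"

instance
  by standard
    (auto simp: scaleC_prod_def prod_eq_iff scaleC_add_right scaleC_add_left scaleC_scaleC
      scaleC_one scaleC_of_real)

end


section \<open>Linear relations\<close>

text \<open>
  A relation is a set of pairs, so that dom, ran and the inverse are \<^const>\<open>Domain\<close>,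
  \<^const>\<open>Range\<close> and \<^const>\<open>converse\<close> (written \<open>S\<inverse>\<close>). An operator whose domain need not
  be the whole space is given either by its graph or by a total function together with its
  domain; values of the function outside of the domain are irrelevant.
\<close>

abbreviation linear_relation :: "('a::complex_vector \<times> 'b::complex_vector) set \<Rightarrow> bool"
  where "linear_relation S \<equiv> cvec.subspace S"

definition rel_ker :: "('a \<times> 'b::zero) set \<Rightarrow> 'a set"
  where "rel_ker S = {f. (f, 0) \<in> S}"

definition rel_shift :: "('a::complex_vector \<times> 'a) set \<Rightarrow> complex \<Rightarrow> ('a \<times> 'a) set"
  where "rel_shift S \<mu> = {(f, f' - \<mu> *\<^sub>C f) | f f'. (f, f') \<in> S}"

definition rel_minus_op :: "('a \<times> 'b) set \<Rightarrow> 'a set \<Rightarrow> ('a \<Rightarrow> 'b::minus) \<Rightarrow> ('a \<times> 'b) set"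
  where "rel_minus_op \<Theta> D M = {(x, y - M x) | x y. (x, y) \<in> \<Theta> \<and> x \<in> D}"

definition op_graph :: "'a set \<Rightarrow> ('a \<Rightarrow> 'b) \<Rightarrow> ('a \<times> 'b) set"
  where "op_graph D F = {(x, F x) | x. x \<in> D}"

text \<open>
  The value at \<open>x\<close> of an operator given by its graph; only meaningful if \<open>R\<close> relates \<open>x\<close>
  to exactly one element.
\<close>

definition rel_apply :: "('a \<times> 'b) set \<Rightarrow> 'a \<Rightarrow> 'b"
  where "rel_apply R x = (THE y. (x, y) \<in> R)"

definition bounded_everywhere_defined_op ::
    "('a::complex_inner \<times> 'b::complex_inner) set \<Rightarrow> bool"
  where "bounded_everywhere_defined_op R \<longleftrightarrow>
    (\<exists>B. bounded_linear B \<and> (\<forall>c x. B (c *\<^sub>C x) = c *\<^sub>C B x) \<and> R = op_graph UNIV B)"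

definition resolvent_set :: "('a::complex_inner \<times> 'a) set \<Rightarrow> complex set"
  where "resolvent_set S = {\<mu>. bounded_everywhere_defined_op ((rel_shift S \<mu>)\<inverse>)}"

definition is_eigenvalue :: "('a::complex_inner \<times> 'a) set \<Rightarrow> complex \<Rightarrow> bool"
  where "is_eigenvalue S \<mu> \<longleftrightarrow> rel_ker (rel_shift S \<mu>) \<noteq> {0}"

text \<open>
  For the graph of a densely defined operator this is the graph of the adjoint operator; hence
  the two spaces are allowed to differ.
\<close>

definition rel_adjoint ::
    "('a::complex_inner \<times> 'b::complex_inner) set \<Rightarrow> ('b \<times> 'a) set"
  where "rel_adjoint S = {(g, g'). \<forall>(f, f') \<in> S. cinner f' g = cinner f g'}"

definition symmetric_relation :: "('a::complex_inner \<times> 'a) set \<Rightarrow> bool"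
  where "symmetric_relation S \<longleftrightarrow> S \<subseteq> rel_adjoint S"

definition selfadjoint_relation :: "('a::complex_inner \<times> 'a) set \<Rightarrow> bool"
  where "selfadjoint_relation S \<longleftrightarrow> S = rel_adjoint S"


section \<open>Quasi boundary triples\<close>

definition clinear_on :: "'a::complex_vector set \<Rightarrow> ('a \<Rightarrow> 'b::complex_vector) \<Rightarrow> bool"
  where "clinear_on T F \<longleftrightarrow> cvec.subspace T \<and>
    (\<forall>x\<in>T. \<forall>y\<in>T. F (x + y) = F x + F y) \<and> (\<forall>c. \<forall>x\<in>T. F (c *\<^sub>C x) = c *\<^sub>C F x)"

definition ker_on :: "'a set \<Rightarrow> ('a \<Rightarrow> 'b::zero) \<Rightarrow> 'a set"
  where "ker_on T F = {x \<in> T. F x = 0}"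

text \<open>
  The boundary space is the type \<open>'g\<close>. The domain \<open>T\<close> of the boundary maps is part of the data;
  only the values of \<open>\<Gamma>0\<close> and \<open>\<Gamma>1\<close> on \<open>T\<close> matter.
\<close>

definition quasi_boundary_triple ::
    "('h::chilbert_space \<times> 'h) set \<Rightarrow> ('h \<times> 'h) set \<Rightarrow>
      ('h \<times> 'h \<Rightarrow> 'g::chilbert_space) \<Rightarrow> ('h \<times> 'h \<Rightarrow> 'g) \<Rightarrow> bool"
  where "quasi_boundary_triple A T \<Gamma>0 \<Gamma>1 \<longleftrightarrow>
    T \<subseteq> rel_adjoint A \<and> rel_adjoint A \<subseteq> closure T \<and>
    clinear_on T \<Gamma>0 \<and> clinear_on T \<Gamma>1 \<and>
    closure ((\<lambda>p. (\<Gamma>0 p, \<Gamma>1 p)) ` T) = UNIV \<and>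
    selfadjoint_relation (ker_on T \<Gamma>0) \<and>
    (\<forall>(f, f') \<in> T. \<forall>(g, g') \<in> T.
      cinner f' g - cinner f g' =
        cinner (\<Gamma>1 (f, f')) (\<Gamma>0 (g, g')) - cinner (\<Gamma>0 (f, f')) (\<Gamma>1 (g, g')))"

definition rel_extension ::
    "('h \<times> 'h) set \<Rightarrow> ('h \<times> 'h \<Rightarrow> 'g) \<Rightarrow> ('h \<times> 'h \<Rightarrow> 'g) \<Rightarrow> ('g \<times> 'g) set \<Rightarrow> ('h \<times> 'h) set"
  where "rel_extension T \<Gamma>0 \<Gamma>1 \<Theta> = {p \<in> T. (\<Gamma>0 p, \<Gamma>1 p) \<in> \<Theta>}"

definition defect_graph :: "('h::complex_vector \<times> 'h) set \<Rightarrow> complex \<Rightarrow> ('h \<times> 'h) set"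
  where "defect_graph T \<mu> = {(f, \<mu> *\<^sub>C f) | f. f \<in> rel_ker (rel_shift T \<mu>)}"

text \<open>
  For \<open>\<mu>\<close> in the resolvent set of \<open>ker \<Gamma>0\<close> the map \<open>\<Gamma>0\<close> is a bijection from
  \<open>defect_graph T \<mu>\<close> onto \<open>\<Gamma>0 ` T\<close>. The \<open>\<gamma>\<close>-field and the Weyl function are operators with
  domain \<open>\<Gamma>0 ` T\<close>.
\<close>

definition gamma_field ::
    "('h::complex_vector \<times> 'h) set \<Rightarrow> ('h \<times> 'h \<Rightarrow> 'g) \<Rightarrow> complex \<Rightarrow> 'g \<Rightarrow> 'h"
  where "gamma_field T \<Gamma>0 \<mu> x = fst (inv_into (defect_graph T \<mu>) \<Gamma>0 x)"

definition weyl_function ::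
    "('h::complex_vector \<times> 'h) set \<Rightarrow> ('h \<times> 'h \<Rightarrow> 'g) \<Rightarrow> ('h \<times> 'h \<Rightarrow> 'g) \<Rightarrow> complex \<Rightarrow> 'g \<Rightarrow> 'g"
  where "weyl_function T \<Gamma>0 \<Gamma>1 \<mu> x = \<Gamma>1 (inv_into (defect_graph T \<mu>) \<Gamma>0 x)"

definition gamma_adjoint ::
    "('h::complex_inner \<times> 'h) set \<Rightarrow> ('h \<times> 'h \<Rightarrow> 'g::complex_inner) \<Rightarrow> complex \<Rightarrow> 'h \<Rightarrow> 'g"
  where "gamma_adjoint T \<Gamma>0 \<mu> = rel_apply (rel_adjoint (op_graph (\<Gamma>0 ` T) (gamma_field T \<Gamma>0 \<mu>)))"

end

(*
  For g in H let u = (A0 - mu)^-1 g. The pair (u, g + mu u) lies in ker Gamma0, and Green's identity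
  against the elements of the defect space at the conjugate point gives
  gamma(conj mu)^* g = Gamma1 (u, g + mu u). Subtracting this pair from an element (f, g + mu f) of T
  leaves an element of the defect space at mu, so f = u + gamma(mu) x, with boundary values
  x and gamma(conj mu)^* g + M(mu) x. Hence (f, g) belongs to A_Theta - mu iff f = u + gamma(mu) x
  for some x with (x, gamma(conj mu)^* g) in Theta - M(mu), and everything follows from this
  description. The conjugate point is handled by taking the adjoint of the resolvent, which exists by
  the Riesz representation theorem.
*)
theory Submission
  imports Defs
begin

section \<open>Complex inner product spaces\<close>

lemma cinner_add_right: "cinner x (y + z) = cinner x y + cinner x z"
  by (metis cinner_add_left cinner_commute complex_cnj_add)

lemma cinner_scaleC_right: "cinner x (c *\<^sub>C y) = cnj c * cinner x y"
  by (metis cinner_commute cinner_scaleC_left complex_cnj_mult)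

lemma cinner_zero_left [simp]: "cinner 0 y = 0"
  by (metis add_cancel_right_left cinner_add_left)

lemma cinner_zero_right [simp]: "cinner x 0 = 0"
  by (metis cinner_commute cinner_zero_left complex_cnj_zero)

lemma cinner_minus_left: "cinner (- x) y = - cinner x y"
  by (metis add.right_inverse add_eq_0_iff cinner_add_left cinner_zero_left)

lemma cinner_diff_left: "cinner (x - y) z = cinner x z - cinner y z"
  using cinner_add_left[of x "- y" z] by (simp add: cinner_minus_left)

lemma cinner_diff_right: "cinner x (y - z) = cinner x y - cinner x z"
  by (metis cinner_commute cinner_diff_left complex_cnj_diff)

lemma Re_cinner_scaleR_left: "Re (cinner (r *\<^sub>R x) y) = r * Re (cinner x y)"
  by (simp add: scaleC_of_real[symmetric] cinner_scaleC_left)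

lemma power2_norm_eq_Re_cinner: "(norm x)\<^sup>2 = Re (cinner x x)" for x :: "'a::complex_inner"
  by (simp add: norm_eq_sqrt_cinner Re_cinner_ge_zero)

lemma Re_cinner_commute: "Re (cinner x y) = Re (cinner y x)"
  by (subst cinner_commute) simp

lemma power2_norm_add:
  "(norm (x + y))\<^sup>2 = (norm x)\<^sup>2 + (norm y)\<^sup>2 + 2 * Re (cinner x y)" for x y :: "'a::complex_inner"
  using Re_cinner_commute[of x y]
  by (simp add: power2_norm_eq_Re_cinner cinner_add_left cinner_add_right)

text \<open>The real part of Cauchy-Schwarz comes out of the triangle inequality, which the norm
  already satisfies: square it and cancel the squared norms.\<close>

lemma Re_cinner_le_norm: "Re (cinner x y) \<le> norm x * norm y"
proof -
  have "(norm (x + y))\<^sup>2 \<le> (norm x + norm y)\<^sup>2"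
    by (intro power_mono norm_triangle_ineq) simp
  then show ?thesis
    by (simp add: power2_norm_add power2_sum)
qed

lemma bounded_linear_Re_cinner_left: "bounded_linear (\<lambda>x. Re (cinner x y))"
proof (rule bounded_linear_intro[where K = "norm y"])
  fix x
  show "norm (Re (cinner x y)) \<le> norm x * norm y"
    using Re_cinner_le_norm[of x y] Re_cinner_le_norm[of "- x" y]
    by (simp add: cinner_minus_left abs_le_iff)
qed (simp_all add: cinner_add_left Re_cinner_scaleR_left)

text \<open>The condition \<open>Re (cinner x k) = 0\<close> is closed in \<open>x\<close>, so it
  passes from \<open>S\<close> to its closure and may be tested at \<open>x = k\<close>, where it
  reads \<open>(norm k)\<^sup>2 = 0\<close>.\<close>

lemma cinner_dense_eq_zero:
  fixes k :: "'a::complex_inner"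
  assumes "closure S = UNIV" and "\<And>x. x \<in> S \<Longrightarrow> cinner x k = 0"
  shows "k = 0"
proof -
  have "closed {x. Re (cinner x k) = 0}"
    by (intro closed_Collect_eq continuous_on_const linear_continuous_on
        bounded_linear_Re_cinner_left)
  moreover have "S \<subseteq> {x. Re (cinner x k) = 0}"
    using assms(2) by auto
  ultimately have "closure S \<subseteq> {x. Re (cinner x k) = 0}"
    by (rule closure_minimal[rotated])
  then have "Re (cinner k k) = 0"
    using assms(1) by blast
  then show ?thesis
    by (simp add: power2_norm_eq_Re_cinner[symmetric])
qed

section \<open>Riesz representation and adjoints of bounded operators\<close>

text \<open>The representing vector is the minimizer of \<open>\<parallel>x\<parallel>\<^sup>2 - 2 \<psi> x\<close>; by the parallelogram law every
  minimizing sequence of this functional is Cauchy.\<close>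

lemma riesz_real:
  fixes \<psi> :: "'a::chilbert_space \<Rightarrow> real"
  assumes \<psi>: "bounded_linear \<psi>"
  shows "\<exists>z. \<forall>x. \<psi> x = Re (cinner x z)"
proof -
  interpret \<psi>: bounded_linear \<psi> by fact
  define J where "J x = (norm x)\<^sup>2 - 2 * \<psi> x" for x
  have J_add: "J (x + y) = J x + J y + 2 * Re (cinner x y)" for x y
    by (simp add: J_def power2_norm_add \<psi>.add)
  have J_scaleR: "J (t *\<^sub>R x) = t\<^sup>2 * (norm x)\<^sup>2 - 2 * t * \<psi> x" for t x
    by (simp add: J_def \<psi>.scaleR power_mult_distrib)
  obtain K where K: "\<And>x. norm (\<psi> x) \<le> norm x * K"
    using \<psi>.bounded by blast
  \<comment> \<open>Completing the square: \<open>J x\<close> is at least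
    \<open>(norm x - K)\<^sup>2 - K\<^sup>2\<close>.\<close>
  have "- K\<^sup>2 \<le> J x" for x
  proof -
    have "0 \<le> (norm x - K)\<^sup>2" by simp
    moreover have "\<psi> x \<le> norm x * K" using K[of x] by simp
    ultimately show ?thesis by (simp add: J_def power2_diff)
  qed
  then have bdd: "bdd_below (range J)"
    by (rule bdd_belowI2)
  define m where "m = Inf (range J)"
  have m_le: "m \<le> J x" for x
    unfolding m_def by (rule cInf_lower[OF _ bdd]) simp
  have "\<exists>x. J x < m + 1 / Suc n" for n
    using cInf_lessD[of "range J" "m + 1 / Suc n"] by (auto simp: m_def)
  then obtain X where X: "\<And>n. J (X n) < m + 1 / Suc n"
    by metis
  \<comment> \<open>By the parallelogram law this is an equality when \<open>m\<close> is replaced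
    by the value of \<open>J\<close> at the midpoint of \<open>x\<close> and \<open>y\<close>, and
    that value is at least \<open>m\<close>.\<close>
  have midpoint: "(norm (x - y))\<^sup>2 \<le> 2 * J x + 2 * J y - 4 * m" for x y
  proof -
    have "4 * J ((1/2) *\<^sub>R (x + y)) = (norm (x + y))\<^sup>2 - 4 * \<psi> x - 4 * \<psi> y"
      by (simp add: J_scaleR \<psi>.add power2_eq_square)
    moreover have "(norm (x - y))\<^sup>2 = (norm x)\<^sup>2 + (norm y)\<^sup>2 - 2 * Re (cinner x y)"
      using Re_cinner_commute[of x y]
      by (simp add: power2_norm_eq_Re_cinner cinner_diff_left cinner_diff_right)
    ultimately show ?thesis
      using m_le[of "(1/2) *\<^sub>R (x + y)"] by (simp add: power2_norm_add J_def)
  qed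
  have "Cauchy X"
  proof (rule metric_CauchyI)
    fix e :: real
    assume "0 < e"
    \<comment> \<open>From index \<open>N\<close> on, the values of \<open>J\<close> along
      \<open>X\<close> stay below \<open>m + 1 / Suc N\<close>, so \<open>midpoint\<close> bounds
      squared distances by \<open>4 / Suc N\<close>.\<close>
    then obtain N where N: "4 / Suc N < e\<^sup>2"
      using reals_Archimedean[of "e\<^sup>2 / 4"] by (auto simp: field_simps)
    have "dist (X a) (X b) < e" if "N \<le> a" "N \<le> b" for a b
    proof (rule power_less_imp_less_base)
      have "J (X n) < m + 1 / Suc N" if "N \<le> n" for n
        using X[of n] that by (smt (verit) frac_le of_nat_0_less_iff of_nat_mono Suc_le_mono zero_less_Suc)
      from this[OF that(1)] this[OF that(2)] show "(dist (X a) (X b))\<^sup>2 < e\<^sup>2"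
        using midpoint[of "X a" "X b"] N by (simp add: dist_norm)
    qed (use \<open>0 < e\<close> in simp)
    then show "\<exists>M. \<forall>a\<ge>M. \<forall>b\<ge>M. dist (X a) (X b) < e" by blast
  qed
  then obtain z where z: "X \<longlonglongrightarrow> z"
    using Cauchy_convergent convergent_def by blast
  have "(\<lambda>n. J (X n)) \<longlonglongrightarrow> J z"
    unfolding J_def by (intro tendsto_intros \<psi>.tendsto z)
  moreover have "(\<lambda>n. m + 1 / real (Suc n)) \<longlonglongrightarrow> m"
    using LIMSEQ_inverse_real_of_nat_add[of m] by (simp add: divide_inverse)
  ultimately have "J z \<le> m"
    by (rule LIMSEQ_le) (use X less_imp_le in blast)
  then have J_min: "J z \<le> J x" for x
    using m_le order_trans by blast
  have "\<psi> x = Re (cinner x z)" for x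
  proof (rule ccontr)
    assume neq: "\<psi> x \<noteq> Re (cinner x z)"
    \<comment> \<open>The minimizer is perturbed to \<open>t *\<^sub>R x + z\<close>. With this step
      size the linear gain outweighs the quadratic cost, so \<open>J\<close> would drop below its
      minimum; the summand 1 keeps the denominator positive.\<close>
    define t where "t = (\<psi> x - Re (cinner x z)) / ((norm x)\<^sup>2 + 1)"
    have n: "0 < (norm x)\<^sup>2 + 1"
      by (simp add: add_nonneg_pos)
    then have d: "\<psi> x - Re (cinner x z) = t * ((norm x)\<^sup>2 + 1)"
      by (simp add: t_def)
    have "0 \<le> t\<^sup>2 * (norm x)\<^sup>2 - 2 * t * (\<psi> x - Re (cinner x z))"
      using J_min[of "t *\<^sub>R x + z"]
      by (simp add: J_add J_scaleR Re_cinner_scaleR_left right_diff_distrib)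
    also have "\<dots> = - (t\<^sup>2 * ((norm x)\<^sup>2 + 2))"
      unfolding d by (simp add: power2_eq_square algebra_simps)
    also have "\<dots> < 0"
      using neq n by (simp add: t_def)
    finally show False by simp
  qed
  then show ?thesis by blast
qed

text \<open>The real part determines the functional: by homogeneity its imaginary part at
  \<open>x\<close> is minus its real part at \<open>\<i> *\<^sub>C x\<close>.\<close>

lemma riesz_representation:
  fixes \<phi> :: "'a::chilbert_space \<Rightarrow> complex"
  assumes "bounded_linear (\<lambda>x. Re (\<phi> x))" and scale: "\<And>c x. \<phi> (c *\<^sub>C x) = c * \<phi> x"
  shows "\<exists>z. \<forall>x. \<phi> x = cinner x z"
proof -
  obtain z where z: "\<And>x. Re (\<phi> x) = Re (cinner x z)"
    using riesz_real[OF assms(1)] by blast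
  have "Im (\<phi> x) = Im (cinner x z)" for x
    using z[of "\<i> *\<^sub>C x"] by (simp add: scale cinner_scaleC_left)
  with z show ?thesis
    by (auto simp: complex_eq_iff)
qed

lemma bounded_operator_has_adjoint:
  fixes B :: "'a::chilbert_space \<Rightarrow> 'b::complex_inner"
  assumes "bounded_linear B" and "\<And>c x. B (c *\<^sub>C x) = c *\<^sub>C B x"
  shows "\<exists>k. \<forall>f. cinner (B f) g = cinner f k"
  by (rule riesz_representation)
    (simp_all add: assms cinner_scaleC_left
      bounded_linear_compose[OF bounded_linear_Re_cinner_left])

section \<open>Resolvents of self-adjoint relations\<close>

lemma mem_rel_shift_iff: "(f, g) \<in> rel_shift S \<mu> \<longleftrightarrow> (f, g + \<mu> *\<^sub>C f) \<in> S"
  by (force simp: rel_shift_def)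

lemma selfadjoint_memD:
  assumes "selfadjoint_relation S" and "(f, f') \<in> S" and "(g, g') \<in> S"
  shows "cinner f' g = cinner f g'"
  using assms by (fastforce simp: selfadjoint_relation_def rel_adjoint_def)

lemma selfadjoint_memI:
  assumes "selfadjoint_relation S" and "\<And>f f'. (f, f') \<in> S \<Longrightarrow> cinner f' g = cinner f g'"
  shows "(g, g') \<in> S"
proof -
  have "(g, g') \<in> rel_adjoint S"
    using assms(2) by (auto simp: rel_adjoint_def)
  with assms(1) show ?thesis
    by (simp add: selfadjoint_relation_def)
qed

text \<open>The unique \<open>f\<close> is the resolvent at \<open>\<mu>\<close> applied to
  \<open>g\<close>. Writing this as membership in \<open>S\<close> avoids shifts and converses in
  later arguments.\<close>

lemma resolvent_set_bij:
  assumes "\<mu> \<in> resolvent_set S"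
  shows "\<exists>!f. (f, g + \<mu> *\<^sub>C f) \<in> S"
proof -
  obtain B where "(rel_shift S \<mu>)\<inverse> = op_graph UNIV B"
    using assms by (auto simp: resolvent_set_def bounded_everywhere_defined_op_def)
  then have "(f, g) \<in> rel_shift S \<mu> \<longleftrightarrow> f = B g" for f
    by (auto simp: op_graph_def set_eq_iff)
  then show ?thesis
    by (simp add: mem_rel_shift_iff)
qed

text \<open>The solution is \<open>k\<close> = B* g with \<open>B\<close> the resolvent at
  \<open>\<mu>\<close>: the adjoint of the resolvent at \<open>\<mu>\<close> inverts the relation
  shifted by \<open>cnj \<mu>\<close>.\<close>

lemma selfadjoint_cnj_bij:
  fixes S :: "('a::chilbert_space \<times> 'a) set"
  assumes S: "selfadjoint_relation S" and \<mu>: "\<mu> \<in> resolvent_set S" and lin: "linear_relation S"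
  shows "\<exists>!f. (f, g + cnj \<mu> *\<^sub>C f) \<in> S"
proof -
  obtain B where B: "bounded_linear B" "\<And>c x. B (c *\<^sub>C x) = c *\<^sub>C B x"
      and "(rel_shift S \<mu>)\<inverse> = op_graph UNIV B"
    using \<mu> by (auto simp: resolvent_set_def bounded_everywhere_defined_op_def)
  then have res: "(f, h + \<mu> *\<^sub>C f) \<in> S \<longleftrightarrow> f = B h" for f h
    by (auto simp: op_graph_def set_eq_iff mem_rel_shift_iff[symmetric])
  obtain k where k: "\<And>f. cinner (B f) g = cinner f k"
    using bounded_operator_has_adjoint[OF B] by blast
  have "(k, g + cnj \<mu> *\<^sub>C k) \<in> S"
  proof (rule selfadjoint_memI[OF S])
    fix u u'
    assume "(u, u') \<in> S"
    \<comment> \<open>Every pair in \<open>S\<close> has its first component in the range of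
      \<open>B\<close>, so the membership test for \<open>S\<close> becomes the defining property of
      \<open>k\<close>.\<close>
    then have "u = B (u' - \<mu> *\<^sub>C u)"
      using res[of u "u' - \<mu> *\<^sub>C u"] by simp
    then show "cinner u' k = cinner u (g + cnj \<mu> *\<^sub>C k)"
      using k[of "u' - \<mu> *\<^sub>C u"]
      by (simp add: cinner_add_right cinner_scaleC_right cinner_diff_left cinner_scaleC_left)
  qed
  moreover have "f = k" if f: "(f, g + cnj \<mu> *\<^sub>C f) \<in> S" for f
  proof -
    \<comment> \<open>Symmetry of \<open>S\<close> is tested on the pair with first component
      \<open>B h\<close>. The terms containing \<open>\<mu>\<close> cancel, leaving
      \<open>cinner h f = cinner (B h) g\<close>.\<close>
    have "cinner h f = cinner h k" for h
    proof -
      have "(B h, h + \<mu> *\<^sub>C B h) \<in> S"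
        using res by blast
      from selfadjoint_memD[OF S this f] show ?thesis
        using k[of h] by (simp add: cinner_add_right cinner_scaleC_right cinner_add_left cinner_scaleC_left)
    qed
    then show ?thesis
      using cinner_dense_eq_zero[of UNIV "f - k"] by (simp add: cinner_diff_right)
  qed
  ultimately show ?thesis by blast
qed

section \<open>Quasi boundary triples\<close>

lemma clinear_on_zero: "clinear_on T F \<Longrightarrow> F 0 = 0"
  unfolding clinear_on_def
  by (metis add_0 add_cancel_right_left cvec.subspace_0)

lemma clinear_on_diff:
  assumes "clinear_on T F" and "p \<in> T" and "q \<in> T"
  shows "F (p - q) = F p - F q"
proof -
  have "p - q \<in> T"
    using assms by (auto simp: clinear_on_def intro: cvec.subspace_diff)
  then have "F (p - q) + F q = F (p - q + q)"
    using assms unfolding clinear_on_def by metis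
  then show ?thesis by (simp add: eq_diff_eq)
qed

lemma clinear_on_subspace: "clinear_on T F \<Longrightarrow> cvec.subspace T"
  by (simp add: clinear_on_def)

lemma subspace_ker_on: "clinear_on T F \<Longrightarrow> cvec.subspace (ker_on T F)"
  using clinear_on_zero[of T F] by (auto simp: cvec.subspace_def clinear_on_def ker_on_def)

text \<open>Linearity is what later turns a trivial kernel of the shifted extension into uniqueness
  of preimages.\<close>

lemma subspace_rel_extension:
  assumes "clinear_on T \<Gamma>0" and "clinear_on T \<Gamma>1" and "linear_relation \<Theta>"
  shows "cvec.subspace (rel_extension T \<Gamma>0 \<Gamma>1 \<Theta>)"
proof (rule cvec.subspaceI)
  show "0 \<in> rel_extension T \<Gamma>0 \<Gamma>1 \<Theta>"
    using assms cvec.subspace_0[OF assms(3)] cvec.subspace_0[of T]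
    by (simp add: rel_extension_def clinear_on_zero clinear_on_subspace zero_prod_def[symmetric])
  show "x + y \<in> rel_extension T \<Gamma>0 \<Gamma>1 \<Theta>"
    if "x \<in> rel_extension T \<Gamma>0 \<Gamma>1 \<Theta>" "y \<in> rel_extension T \<Gamma>0 \<Gamma>1 \<Theta>" for x y
    using assms that cvec.subspace_add[OF assms(3), of "(\<Gamma>0 x, \<Gamma>1 x)" "(\<Gamma>0 y, \<Gamma>1 y)"]
    by (auto simp: rel_extension_def clinear_on_def cvec.subspace_add)
  show "c *\<^sub>C x \<in> rel_extension T \<Gamma>0 \<Gamma>1 \<Theta>" if "x \<in> rel_extension T \<Gamma>0 \<Gamma>1 \<Theta>" for c x
    using assms that cvec.subspace_scale[OF assms(3), of "(\<Gamma>0 x, \<Gamma>1 x)" c]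
    by (auto simp: rel_extension_def clinear_on_def cvec.subspace_scale
        scaleC_prod_def[of c "(\<Gamma>0 x, \<Gamma>1 x)"])
qed

section \<open>Defect spaces, gamma-field and Weyl function\<close>

lemma mem_defect_graph_iff: "p \<in> defect_graph T \<mu> \<longleftrightarrow> p \<in> T \<and> snd p = \<mu> *\<^sub>C fst p"
  by (cases p) (auto simp: defect_graph_def rel_ker_def mem_rel_shift_iff)

text \<open>Unique solvability splits \<open>T\<close> as the direct sum of
  \<open>ker_on T \<Gamma>0\<close> and the defect graph. It is assumed in this bare form so that
  the result can be applied at \<open>\<mu>\<close> and at \<open>cnj \<mu>\<close> alike.\<close>

lemma bij_betw_defect_graph:
  assumes \<Gamma>0: "clinear_on T \<Gamma>0" and ex1: "\<And>g. \<exists>!f. (f, g + \<mu> *\<^sub>C f) \<in> ker_on T \<Gamma>0"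
  shows "bij_betw \<Gamma>0 (defect_graph T \<mu>) (\<Gamma>0 ` T)"
proof -
  note T = clinear_on_subspace[OF \<Gamma>0]
  have "inj_on \<Gamma>0 (defect_graph T \<mu>)"
  proof (rule inj_onI)
    fix p q
    assume p: "p \<in> defect_graph T \<mu>" and q: "q \<in> defect_graph T \<mu>" and eq: "\<Gamma>0 p = \<Gamma>0 q"
    have "p - q \<in> ker_on T \<Gamma>0"
      using p q eq by (simp add: mem_defect_graph_iff ker_on_def clinear_on_diff[OF \<Gamma>0]
          cvec.subspace_diff[OF T])
    moreover have snd: "snd (p - q) = \<mu> *\<^sub>C fst (p - q)"
      using p q by (simp add: mem_defect_graph_iff cvec.scale_right_diff_distrib)
    ultimately have "(fst (p - q), 0 + \<mu> *\<^sub>C fst (p - q)) \<in> ker_on T \<Gamma>0"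
      by (metis add_0 prod.collapse)
    moreover have "(0, 0 + \<mu> *\<^sub>C 0) \<in> ker_on T \<Gamma>0"
      using cvec.subspace_0[OF subspace_ker_on[OF \<Gamma>0]] by (simp add: zero_prod_def)
    ultimately have "fst (p - q) = 0"
      using ex1[of 0] by blast
    with snd show "p = q"
      by (simp add: prod_eq_iff)
  qed
  moreover have "\<Gamma>0 p \<in> \<Gamma>0 ` defect_graph T \<mu>" if p: "p \<in> T" for p
  proof -
    \<comment> \<open>The pair \<open>?q\<close> in the kernel of \<open>\<Gamma>0\<close> has the
      same image under T - mu as \<open>p\<close>, so \<open>p - ?q\<close> lands in the defect
      graph with unchanged \<open>\<Gamma>0\<close>.\<close>
    obtain u where u: "(u, snd p - \<mu> *\<^sub>C fst p + \<mu> *\<^sub>C u) \<in> ker_on T \<Gamma>0" (is "?q \<in> _")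
      using ex1 by blast
    then have q: "?q \<in> T" "\<Gamma>0 ?q = 0"
      by (simp_all add: ker_on_def)
    have "p - ?q \<in> defect_graph T \<mu>"
      using p q by (simp add: mem_defect_graph_iff cvec.subspace_diff[OF T]
          cvec.scale_right_diff_distrib)
    moreover have "\<Gamma>0 (p - ?q) = \<Gamma>0 p"
      using clinear_on_diff[OF \<Gamma>0 p q(1)] q(2) by simp
    ultimately show ?thesis by (metis imageI)
  qed
  ultimately show ?thesis
    by (auto simp: bij_betw_def mem_defect_graph_iff)
qed

text \<open>The choice made by \<open>inv_into\<close> is a genuine preimage in the defect graph,
  hence of the form \<open>p\<close>; this gives access to the values of the gamma-field and the
  Weyl function.\<close>

lemma defect_element:
  assumes "bij_betw \<Gamma>0 (defect_graph T \<mu>) (\<Gamma>0 ` T)" and "x \<in> \<Gamma>0 ` T"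
  defines "p \<equiv> (gamma_field T \<Gamma>0 \<mu> x, \<mu> *\<^sub>C gamma_field T \<Gamma>0 \<mu> x)"
  shows "p \<in> T" and "\<Gamma>0 p = x" and "\<Gamma>1 p = weyl_function T \<Gamma>0 \<Gamma>1 \<mu> x"
proof -
  have x: "x \<in> \<Gamma>0 ` defect_graph T \<mu>"
    using assms by (simp add: bij_betw_def)
  then have mem: "inv_into (defect_graph T \<mu>) \<Gamma>0 x \<in> defect_graph T \<mu>"
    by (rule inv_into_into)
  then have p: "inv_into (defect_graph T \<mu>) \<Gamma>0 x = p"
    by (simp add: p_def gamma_field_def prod_eq_iff mem_defect_graph_iff)
  show "p \<in> T"
    using mem p by (simp add: mem_defect_graph_iff)
  show "\<Gamma>0 p = x"
    using f_inv_into_f[OF x] p by simp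
  show "\<Gamma>1 p = weyl_function T \<Gamma>0 \<Gamma>1 \<mu> x"
    using p by (simp add: weyl_function_def)
qed

lemma gamma_field_boundary_value:
  assumes bij: "bij_betw \<Gamma>0 (defect_graph T \<mu>) (\<Gamma>0 ` T)" and p: "(f, \<mu> *\<^sub>C f) \<in> T"
  shows "gamma_field T \<Gamma>0 \<mu> (\<Gamma>0 (f, \<mu> *\<^sub>C f)) = f"
  using bij p inv_into_f_f[of \<Gamma>0 "defect_graph T \<mu>" "(f, \<mu> *\<^sub>C f)"]
  by (simp add: gamma_field_def bij_betw_def mem_defect_graph_iff)

lemma gamma_field_zero:
  fixes T :: "('a::complex_vector \<times> 'a) set"
  assumes "clinear_on T \<Gamma>0" and "bij_betw \<Gamma>0 (defect_graph T \<mu>) (\<Gamma>0 ` T)"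
  shows "gamma_field T \<Gamma>0 \<mu> 0 = 0"
proof -
  have zero: "(0, \<mu> *\<^sub>C 0) = (0 :: 'a \<times> 'a)"
    by (simp add: zero_prod_def)
  have "(0, \<mu> *\<^sub>C 0) \<in> T"
    unfolding zero by (rule cvec.subspace_0[OF clinear_on_subspace[OF assms(1)]])
  from gamma_field_boundary_value[OF assms(2) this] show ?thesis
    unfolding zero clinear_on_zero[OF assms(1)] .
qed

text \<open>The vector \<open>gamma_field T \<Gamma>0 \<mu> x\<close> determines the whole defect
  element, and \<open>\<Gamma>0\<close> recovers \<open>x\<close> from it.\<close>

lemma inj_on_gamma_field:
  assumes "bij_betw \<Gamma>0 (defect_graph T \<mu>) (\<Gamma>0 ` T)"
  shows "inj_on (gamma_field T \<Gamma>0 \<mu>) (\<Gamma>0 ` T)"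
proof (rule inj_onI)
  fix x y
  assume x: "x \<in> \<Gamma>0 ` T" and y: "y \<in> \<Gamma>0 ` T"
    and "gamma_field T \<Gamma>0 \<mu> x = gamma_field T \<Gamma>0 \<mu> y"
  then show "x = y"
    using defect_element(2)[OF assms x] defect_element(2)[OF assms y] by metis
qed

section \<open>The adjoint of the gamma-field\<close>

lemma dense_range_fst:
  fixes F :: "'a \<Rightarrow> 'b::topological_space" and G :: "'a \<Rightarrow> 'c::topological_space"
  assumes "closure ((\<lambda>p. (F p, G p)) ` T) = UNIV"
  shows "closure (F ` T) = UNIV"
proof -
  have "(\<lambda>p. (F p, G p)) ` T \<subseteq> F ` T \<times> UNIV" by auto
  from closure_mono[OF this] have "UNIV \<subseteq> closure (F ` T) \<times> (UNIV :: 'c set)"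
    by (simp only: assms closure_Times closure_UNIV)
  then show ?thesis by blast
qed

lemma mem_rel_adjoint_op_graph_iff:
  "(g, k) \<in> rel_adjoint (op_graph D F) \<longleftrightarrow> (\<forall>x\<in>D. cinner (F x) g = cinner x k)"
  by (auto simp: rel_adjoint_def op_graph_def)

lemma green_identity:
  assumes "quasi_boundary_triple A T \<Gamma>0 \<Gamma>1" and p: "(f, f') \<in> T" and q: "(g, g') \<in> T"
  shows "cinner f' g - cinner f g' =
    cinner (\<Gamma>1 (f, f')) (\<Gamma>0 (g, g')) - cinner (\<Gamma>0 (f, f')) (\<Gamma>1 (g, g'))"
proof -
  have "\<forall>(f, f') \<in> T. \<forall>(g, g') \<in> T. cinner f' g - cinner f g' =
      cinner (\<Gamma>1 (f, f')) (\<Gamma>0 (g, g')) - cinner (\<Gamma>0 (f, f')) (\<Gamma>1 (g, g'))"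
    using assms(1) by (simp add: quasi_boundary_triple_def)
  from bspec[OF this p, unfolded prod.case] show ?thesis
    using q by blast
qed

text \<open>In Green's identity one boundary term drops out because \<open>\<Gamma>0\<close>
  vanishes at the pair of \<open>u\<close>, and the shifts by \<open>cnj \<mu>\<close> and
  \<open>\<mu>\<close> cancel across the inner product.\<close>

lemma gamma_adjoint_eq:
  assumes qbt: "quasi_boundary_triple A T \<Gamma>0 \<Gamma>1"
    and bij: "bij_betw \<Gamma>0 (defect_graph T (cnj \<mu>)) (\<Gamma>0 ` T)"
    and u: "(u, g + \<mu> *\<^sub>C u) \<in> ker_on T \<Gamma>0"
  shows "gamma_adjoint T \<Gamma>0 (cnj \<mu>) g = \<Gamma>1 (u, g + \<mu> *\<^sub>C u)"
proof -
  let ?\<gamma> = "gamma_field T \<Gamma>0 (cnj \<mu>)" and ?k = "\<Gamma>1 (u, g + \<mu> *\<^sub>C u)"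
  have \<gamma>: "cinner (?\<gamma> x) g = cinner x ?k" if x: "x \<in> \<Gamma>0 ` T" for x
  proof -
    note e = defect_element[OF bij x]
    have "cinner (cnj \<mu> *\<^sub>C ?\<gamma> x) u - cinner (?\<gamma> x) (g + \<mu> *\<^sub>C u) = - cinner x ?k"
      using green_identity[OF qbt e(1), of u "g + \<mu> *\<^sub>C u"] e(2) u by (simp add: ker_on_def)
    then show ?thesis
      by (simp add: cinner_add_right cinner_scaleC_right cinner_scaleC_left)
  qed
  \<comment> \<open>The gamma-field is densely defined, so its adjoint is single-valued and the
    \<open>THE\<close> in \<open>rel_apply\<close> picks out \<open>?k\<close>.\<close>
  have dense: "closure (\<Gamma>0 ` T) = UNIV"
    by (rule dense_range_fst[where G = \<Gamma>1]) (use qbt in \<open>simp add: quasi_boundary_triple_def\<close>)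
  have unique: "k = ?k" if "\<forall>x \<in> \<Gamma>0 ` T. cinner (?\<gamma> x) g = cinner x k" for k
  proof -
    have "k - ?k = 0"
      using dense
      by (rule cinner_dense_eq_zero) (metis that \<gamma> cinner_diff_right right_minus_eq)
    then show ?thesis by simp
  qed
  show ?thesis
    unfolding gamma_adjoint_def rel_apply_def
    unfolding mem_rel_adjoint_op_graph_iff by (rule the_equality) (use \<gamma> unique in blast)+
qed

section \<open>Description of the shifted extension\<close>

lemma mem_rel_minus_op_iff: "(x, k) \<in> rel_minus_op \<Theta> D M \<longleftrightarrow> x \<in> D \<and> (x, k + M x) \<in> \<Theta>"
  for k :: "'b::group_add"
  by (force simp: rel_minus_op_def)

text \<open>Subtracting the resolvent pair \<open>?q\<close> from \<open>?p\<close> leaves the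
  defect element \<open>?e\<close>. The parameter \<open>x\<close> is \<open>\<Gamma>0 ?e\<close>,
  and the Weyl function accounts for \<open>\<Gamma>1 ?e\<close>, so that only
  \<open>\<Gamma>1 ?q\<close> remains after subtracting it.\<close>

lemma rel_shift_extension_iff:
  assumes \<Gamma>0: "clinear_on T \<Gamma>0" and \<Gamma>1: "clinear_on T \<Gamma>1"
    and bij: "bij_betw \<Gamma>0 (defect_graph T \<mu>) (\<Gamma>0 ` T)"
    and u: "(u, g + \<mu> *\<^sub>C u) \<in> ker_on T \<Gamma>0"
  shows "(f, g) \<in> rel_shift (rel_extension T \<Gamma>0 \<Gamma>1 \<Theta>) \<mu> \<longleftrightarrow>
    (\<exists>x. (x, \<Gamma>1 (u, g + \<mu> *\<^sub>C u)) \<in> rel_minus_op \<Theta> (\<Gamma>0 ` T) (weyl_function T \<Gamma>0 \<Gamma>1 \<mu>) \<and>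
      f = u + gamma_field T \<Gamma>0 \<mu> x)"
    (is "?L \<longleftrightarrow> (\<exists>x. ?R x)")
proof -
  note T = clinear_on_subspace[OF \<Gamma>0]
  let ?q = "(u, g + \<mu> *\<^sub>C u)" and ?p = "(f, g + \<mu> *\<^sub>C f)"
  let ?e = "(f - u, \<mu> *\<^sub>C (f - u))"
  have q: "?q \<in> T" "\<Gamma>0 ?q = 0"
    using u by (simp_all add: ker_on_def)
  have e: "?e = ?p - ?q"
    by (simp add: cvec.scale_right_diff_distrib)
  then have p: "?p = ?e + ?q" by simp
  have T_iff: "?p \<in> T \<longleftrightarrow> ?e \<in> T"
    using cvec.subspace_diff[OF T _ q(1)] cvec.subspace_add[OF T _ q(1)] e p by metis
  have \<Gamma>: "\<Gamma>0 ?p = \<Gamma>0 ?e" "\<Gamma>1 ?p = \<Gamma>1 ?e + \<Gamma>1 ?q" if "?e \<in> T"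
  proof -
    have "\<Gamma>0 (?e + ?q) = \<Gamma>0 ?e + \<Gamma>0 ?q" "\<Gamma>1 (?e + ?q) = \<Gamma>1 ?e + \<Gamma>1 ?q"
      using that q(1) \<Gamma>0 \<Gamma>1 unfolding clinear_on_def by metis+
    then show "\<Gamma>0 ?p = \<Gamma>0 ?e" "\<Gamma>1 ?p = \<Gamma>1 ?e + \<Gamma>1 ?q"
      unfolding p[symmetric] using q(2) by simp_all
  qed
  have "?L \<longleftrightarrow> ?e \<in> T \<and> (\<Gamma>0 ?e, \<Gamma>1 ?q + \<Gamma>1 ?e) \<in> \<Theta>"
    unfolding mem_rel_shift_iff rel_extension_def
    using T_iff \<Gamma> by (auto simp: add.commute)
  also have "\<dots> \<longleftrightarrow> (\<exists>x. ?R x)"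
  proof
    assume L: "?e \<in> T \<and> (\<Gamma>0 ?e, \<Gamma>1 ?q + \<Gamma>1 ?e) \<in> \<Theta>"
    then have \<gamma>: "gamma_field T \<Gamma>0 \<mu> (\<Gamma>0 ?e) = f - u"
      by (intro gamma_field_boundary_value[OF bij]) simp
    moreover have "weyl_function T \<Gamma>0 \<Gamma>1 \<mu> (\<Gamma>0 ?e) = \<Gamma>1 ?e"
      using defect_element(3)[OF bij, of "\<Gamma>0 ?e" \<Gamma>1] L unfolding \<gamma> by simp
    ultimately have "?R (\<Gamma>0 ?e)"
      using L by (simp add: mem_rel_minus_op_iff)
    then show "\<exists>x. ?R x" ..
  next
    assume "\<exists>x. ?R x"
    then obtain x where x: "x \<in> \<Gamma>0 ` T" "(x, \<Gamma>1 ?q + weyl_function T \<Gamma>0 \<Gamma>1 \<mu> x) \<in> \<Theta>"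
        and f: "f - u = gamma_field T \<Gamma>0 \<mu> x"
      unfolding mem_rel_minus_op_iff by (metis add_diff_cancel_left')
    show "?e \<in> T \<and> (\<Gamma>0 ?e, \<Gamma>1 ?q + \<Gamma>1 ?e) \<in> \<Theta>"
      using defect_element[OF bij x(1)] x(2) unfolding f by metis
  qed
  finally show ?thesis .
qed

section \<open>Eigenvalues, ranges and the resolvent formula\<close>

lemma rel_apply_converse_eq:
  assumes "(f, g) \<in> R" and "\<And>f'. (f', g) \<in> R \<Longrightarrow> f' = f"
  shows "rel_apply (R\<inverse>) g = f"
  unfolding rel_apply_def by (rule the_equality) (use assms in blast)+

theorem theorem3p10:
  fixes A T A0 A\<Theta> :: "('h::chilbert_space \<times> 'h) set"
    and \<Gamma>0 \<Gamma>1 :: "'h \<times> 'h \<Rightarrow> 'g::chilbert_space"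
    and \<Theta> \<Theta>M :: "('g \<times> 'g) set"
    and \<mu> :: complex
  assumes "linear_relation A" and "closed A" and "symmetric_relation A"
    and "quasi_boundary_triple A T \<Gamma>0 \<Gamma>1"
    and "linear_relation \<Theta>"
    and A0_eq: "A0 = ker_on T \<Gamma>0"
    and A\<Theta>_eq: "A\<Theta> = rel_extension T \<Gamma>0 \<Gamma>1 \<Theta>"
    and \<Theta>M_eq: "\<Theta>M = rel_minus_op \<Theta> (\<Gamma>0 ` T) (weyl_function T \<Gamma>0 \<Gamma>1 \<mu>)"
    and "\<mu> \<in> resolvent_set A0"
  shows "(\<not> is_eigenvalue A\<Theta> \<mu> \<longleftrightarrow> rel_ker \<Theta>M = {0}) \<and>
    (\<not> is_eigenvalue A\<Theta> \<mu> \<longrightarrow>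
      (\<forall>g. g \<in> Range (rel_shift A\<Theta> \<mu>) \<longleftrightarrow>
        gamma_adjoint T \<Gamma>0 (cnj \<mu>) g \<in> Domain (\<Theta>M\<inverse>)) \<and>
      (\<forall>g \<in> Range (rel_shift A\<Theta> \<mu>).
        rel_apply ((rel_shift A\<Theta> \<mu>)\<inverse>) g =
          rel_apply ((rel_shift A0 \<mu>)\<inverse>) g +
          gamma_field T \<Gamma>0 \<mu> (rel_apply (\<Theta>M\<inverse>) (gamma_adjoint T \<Gamma>0 (cnj \<mu>) g))))"
proof -
  let ?\<gamma> = "gamma_field T \<Gamma>0 \<mu>" and ?\<gamma>ad = "gamma_adjoint T \<Gamma>0 (cnj \<mu>)"
  note qbt = \<open>quasi_boundary_triple A T \<Gamma>0 \<Gamma>1\<close>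
  have \<Gamma>0: "clinear_on T \<Gamma>0" and \<Gamma>1: "clinear_on T \<Gamma>1" and sa: "selfadjoint_relation A0"
    using qbt by (simp_all add: quasi_boundary_triple_def A0_eq)
  note A0_lin = subspace_ker_on[OF \<Gamma>0, folded A0_eq]
  note res = resolvent_set_bij[OF \<open>\<mu> \<in> resolvent_set A0\<close>]
  note bij = bij_betw_defect_graph[OF \<Gamma>0 res[unfolded A0_eq]]
  note cnj_bij = bij_betw_defect_graph[OF \<Gamma>0
      selfadjoint_cnj_bij[OF sa \<open>\<mu> \<in> resolvent_set A0\<close> A0_lin, unfolded A0_eq]]
  have rel_shift_iff: "(f, g) \<in> rel_shift A\<Theta> \<mu> \<longleftrightarrow> (\<exists>x. (x, ?\<gamma>ad g) \<in> \<Theta>M \<and> f = u + ?\<gamma> x)"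
    if "(u, g + \<mu> *\<^sub>C u) \<in> A0" for f g u
    using rel_shift_extension_iff[OF \<Gamma>0 \<Gamma>1 bij] gamma_adjoint_eq[OF qbt cnj_bij] that
    by (simp add: A0_eq A\<Theta>_eq \<Theta>M_eq)
  have \<Theta>M_dom: "x \<in> \<Gamma>0 ` T" if "(x, k) \<in> \<Theta>M" for x k
    using that by (simp add: \<Theta>M_eq mem_rel_minus_op_iff)
  have zero: "(0, 0 + \<mu> *\<^sub>C 0) \<in> A0"
    using cvec.subspace_0[OF A0_lin] by (simp add: zero_prod_def)
  have "?\<gamma>ad 0 = 0"
    using gamma_adjoint_eq[OF qbt cnj_bij zero[unfolded A0_eq]] clinear_on_zero[OF \<Gamma>1]
    by (simp add: zero_prod_def)
  \<comment> \<open>This is \<open>rel_shift_iff\<close> at \<open>g = 0\<close>, where the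
    resolvent contributes \<open>u = 0\<close> and \<open>?\<gamma>ad 0 = 0\<close>.\<close>
  then have ker: "rel_ker (rel_shift A\<Theta> \<mu>) = ?\<gamma> ` rel_ker \<Theta>M"
    using rel_shift_iff[OF zero] by (auto simp: rel_ker_def)
  have ker_dom: "rel_ker \<Theta>M \<subseteq> \<Gamma>0 ` T"
    using \<Theta>M_dom by (auto simp: rel_ker_def)
  have "0 \<in> \<Gamma>0 ` T"
    using clinear_on_zero[OF \<Gamma>0] cvec.subspace_0[OF clinear_on_subspace[OF \<Gamma>0]] by force
  \<comment> \<open>The gamma-field is injective and fixes zero, so the image of
    \<open>rel_ker \<Theta>M\<close> is \<open>{0}\<close> exactly when
    \<open>rel_ker \<Theta>M\<close> is.\<close>
  then have eigen: "\<not> is_eigenvalue A\<Theta> \<mu> \<longleftrightarrow> rel_ker \<Theta>M = {0}"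
    using inj_on_image_eq_iff[OF inj_on_gamma_field[OF bij] ker_dom, of "{0}"]
    by (simp add: is_eigenvalue_def ker gamma_field_zero[OF \<Gamma>0 bij])
  have range_iff: "g \<in> Range (rel_shift A\<Theta> \<mu>) \<longleftrightarrow> ?\<gamma>ad g \<in> Domain (\<Theta>M\<inverse>)" for g
  proof -
    obtain u where "(u, g + \<mu> *\<^sub>C u) \<in> A0"
      using res by blast
    then show ?thesis
      by (auto simp: rel_shift_iff Range_iff)
  qed
  have krein: "rel_apply ((rel_shift A\<Theta> \<mu>)\<inverse>) g =
      rel_apply ((rel_shift A0 \<mu>)\<inverse>) g + ?\<gamma> (rel_apply (\<Theta>M\<inverse>) (?\<gamma>ad g))"
    if not_ev: "\<not> is_eigenvalue A\<Theta> \<mu>" and g: "g \<in> Range (rel_shift A\<Theta> \<mu>)" for g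
  proof -
    obtain u where u: "(u, g + \<mu> *\<^sub>C u) \<in> A0"
      using res by blast
    have unique: "f = f'" if "(f, g) \<in> rel_shift A\<Theta> \<mu>" "(f', g) \<in> rel_shift A\<Theta> \<mu>" for f f'
    proof -
      have "cvec.subspace A\<Theta>"
        unfolding A\<Theta>_eq by (rule subspace_rel_extension[OF \<Gamma>0 \<Gamma>1 \<open>linear_relation \<Theta>\<close>])
      from cvec.subspace_diff[OF this that[unfolded mem_rel_shift_iff]]
      have "f - f' \<in> rel_ker (rel_shift A\<Theta> \<mu>)"
        by (simp add: rel_ker_def mem_rel_shift_iff cvec.scale_right_diff_distrib)
      then show ?thesis
        using not_ev by (simp add: is_eigenvalue_def)
    qed
    obtain x where x: "(x, ?\<gamma>ad g) \<in> \<Theta>M"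
      using g by (auto simp: range_iff)
    have f: "(u + ?\<gamma> x, g) \<in> rel_shift A\<Theta> \<mu>"
      using x rel_shift_iff[OF u] by blast
    \<comment> \<open>Two values of \<open>\<Theta>M\<inverse>\<close> at
      \<open>?\<gamma>ad g\<close> would give two preimages of \<open>g\<close>. These agree since
      \<open>\<mu>\<close> is not an eigenvalue, and injectivity of the gamma-field identifies the
      values.\<close>
    have "y = x" if y: "(y, ?\<gamma>ad g) \<in> \<Theta>M" for y
    proof -
      have "u + ?\<gamma> y = u + ?\<gamma> x"
        using y rel_shift_iff[OF u] by (intro unique[OF _ f]) blast
      then show ?thesis
        using inj_onD[OF inj_on_gamma_field[OF bij]] \<Theta>M_dom x y by simp
    qed
    then have "rel_apply (\<Theta>M\<inverse>) (?\<gamma>ad g) = x"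
      using x by (rule rel_apply_converse_eq[rotated])
    moreover have "rel_apply ((rel_shift A0 \<mu>)\<inverse>) g = u"
      by (rule rel_apply_converse_eq) (use u res in \<open>auto simp: mem_rel_shift_iff\<close>)
    moreover have "rel_apply ((rel_shift A\<Theta> \<mu>)\<inverse>) g = u + ?\<gamma> x"
      by (rule rel_apply_converse_eq[OF f]) (rule unique[OF _ f])
    ultimately show ?thesis by simp
  qed
  show ?thesis
    by (intro conjI impI allI ballI eigen range_iff krein)
qed

end
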